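(* If $\Delta$ is an Eulerian manifold, then $\Delta$ has weak Property E. If, in addition, $\Delta$ has odd dimension or $\Delta$ is an Eulerian sphere, then $\Delta$ has Property E.
   Context: Simplicial complexes are finite abstract simplicial complexes, and the empty face is counted as a face. For a $(d-1)$-dimensional simplicial complex $\Delta$, let $f_i$ be the number of $i$-dimensional faces, with $f_{-1}=1$ (the empty face). The $e$-vector $(e_0,\dots,e_d)$ of $\Delta$ is the vector of coefficients of $\sum_{i=0}^d f_{i-1}(t-1)^i=\sum_{k=0}^d e_k t^k$, i.e. $e_k=\sum_{i=k}^d(-1)^{i-k}\binom{i}{k}f_{i-1}$. $\Delta$ has Property E if $e_k=(-1)^{d-k}f_{k-1}$ for every $0\le k\le d$; $\Delta$ has weak Property E if these equalities hold for every $1\le k\le d$. The ordinary (unreduced) Euler characteristic, ignoring the empty face, is $\tilde{\chi}(\Delta)=\sum_{i\ge 0}(-1)^i f_i$ (so $\tilde\chi(\{\emptyset\})=0$). The link of $\sigma\in\Delta$ is $\mathrm{Lk}\,\sigma=\{\tau\in\Delta\mid \sigma\cup\tau\in\Delta,\ \sigma\cap\tau=\emptyset\}$. A simplicial complex is pure if all its maximal faces have the same dimension. A pure $(d-1)$-dimensional simplicial complex $\Delta$ is an Eulerian manifold if for every nonempty simplex $\sigma\in\Delta$ we have $\tilde\chi(\mathrm{Lk}\,\sigma)=1+(-1)^{d-\dim\sigma}$. An Eulerian manifold $\Delta$ is an Eulerian sphere if additionally $\tilde\chi(\Delta)=1+(-1)^{d-1}$. *)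

theory Defs
  imports "HOL-Computational_Algebra.Polynomial"
begin

(* The empty face always belongs to the complex, so the void complex {} is excluded. *)
definition abstract_simplicial_complex :: "'a set set \<Rightarrow> bool" where
  "abstract_simplicial_complex K \<longleftrightarrow>
     finite K \<and> {} \<in> K \<and> (\<forall>s\<in>K. finite s) \<and> (\<forall>s\<in>K. \<forall>t. t \<subseteq> s \<longrightarrow> t \<in> K)"

definition face_dim :: "'a set \<Rightarrow> int" where
  "face_dim s = int (card s) - 1"

(* The complex {{}} has dimension -1. *)
definition complex_dim :: "'a set set \<Rightarrow> int" where
  "complex_dim K = Max (face_dim ` K)"

(* The number d for a (d-1)-dimensional complex. *)
definition complex_rank :: "'a set set \<Rightarrow> nat" where
  "complex_rank K = nat (complex_dim K + 1)"

(* f_i for i >= -1; the index is an integer so that f_{-1} counts the empty face. *)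
definition f_num :: "'a set set \<Rightarrow> int \<Rightarrow> nat" where
  "f_num K i = card {s \<in> K. face_dim s = i}"

definition e_poly :: "'a set set \<Rightarrow> int poly" where
  "e_poly K = (\<Sum>i=0..complex_rank K. smult (int (f_num K (int i - 1))) ([:-1, 1:] ^ i))"

definition e_num :: "'a set set \<Rightarrow> nat \<Rightarrow> int" where
  "e_num K k = coeff (e_poly K) k"

definition property_E :: "'a set set \<Rightarrow> bool" where
  "property_E K \<longleftrightarrow>
     (\<forall>k\<in>{0..complex_rank K}.
        e_num K k = (-1) ^ (complex_rank K - k) * int (f_num K (int k - 1)))"

definition weak_property_E :: "'a set set \<Rightarrow> bool" where
  "weak_property_E K \<longleftrightarrow>
     (\<forall>k\<in>{1..complex_rank K}.
        e_num K k = (-1) ^ (complex_rank K - k) * int (f_num K (int k - 1)))"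

(* Unreduced: the empty face is not counted, and the value at {{}} is 0. *)
definition euler_char :: "'a set set \<Rightarrow> int" where
  "euler_char K = (\<Sum>i\<in>{0..complex_dim K}. (-1) ^ nat i * int (f_num K i))"

definition face_link :: "'a set set \<Rightarrow> 'a set \<Rightarrow> 'a set set" where
  "face_link K s = {t \<in> K. s \<union> t \<in> K \<and> s \<inter> t = {}}"

definition maximal_face :: "'a set set \<Rightarrow> 'a set \<Rightarrow> bool" where
  "maximal_face K s \<longleftrightarrow> s \<in> K \<and> (\<forall>t\<in>K. s \<subseteq> t \<longrightarrow> t = s)"

definition pure_complex :: "'a set set \<Rightarrow> bool" where
  "pure_complex K \<longleftrightarrow>
     (\<forall>s t. maximal_face K s \<longrightarrow> maximal_face K t \<longrightarrow> face_dim s = face_dim t)"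

(* In a complex of dimension d-1 every face s satisfies d - dim s >= 1,
   so nat does not truncate here. *)
definition eulerian_manifold :: "'a set set \<Rightarrow> bool" where
  "eulerian_manifold K \<longleftrightarrow>
     pure_complex K \<and>
     (\<forall>s\<in>K. s \<noteq> {} \<longrightarrow>
        euler_char (face_link K s) = 1 + (-1) ^ nat (int (complex_rank K) - face_dim s))"

(* The exponent d + 1 replaces d - 1, which on nat would be truncated to the wrong
   parity for d = 0. *)
definition eulerian_sphere :: "'a set set \<Rightarrow> bool" where
  "eulerian_sphere K \<longleftrightarrow>
     eulerian_manifold K \<and> euler_char K = 1 + (-1) ^ (complex_rank K + 1)"

end

theory Submission
  imports Defs
begin

text \<open>
  Write \<open>d\<close> for the rank of \<open>K\<close> and \<open>a \<sigma> = \<Sum> (-1) ^ |\<tau>|\<close>, summed over all faces \<open>\<tau>\<close> that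
  contain \<open>\<sigma>\<close>. The coefficient of \<open>t ^ k\<close> in \<open>(t - 1) ^ |\<tau>|\<close> is \<open>(-1) ^ (|\<tau>| - k)\<close> times the
  number of \<open>k\<close>-element subsets of \<open>\<tau>\<close>, so counting pairs \<open>\<sigma> \<subseteq> \<tau>\<close> with \<open>|\<sigma>| = k\<close> in the other
  order gives \<open>e\<^sub>k = (-1) ^ k * \<Sum> a \<sigma>\<close>, summed over the faces \<open>\<sigma>\<close> of cardinality \<open>k\<close> (lemma
  \<open>e_num_eq_coface_sums\<close>). Property E at \<open>k\<close> therefore holds as soon as \<open>a \<sigma> = (-1) ^ d\<close> for
  each of these faces. The faces containing \<open>\<sigma>\<close> are the faces of the link enlarged by \<open>\<sigma>\<close>, so
  \<open>a \<sigma> = (-1) ^ |\<sigma>| * (1 - \<chi>(Lk \<sigma>))\<close>, and for nonempty \<open>\<sigma>\<close> the Eulerian condition on links says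
  precisely that this is \<open>(-1) ^ d\<close>. This is weak Property E.

  The case \<open>k = 0\<close> concerns \<open>a {} = 1 - \<chi>(K)\<close> alone. For a sphere its value is prescribed. In odd
  dimension, where \<open>d\<close> is even, it is forced by a self-duality: in every complex the double sum of
  \<open>(-1) ^ |\<sigma>| * (-1) ^ |\<tau>|\<close> over pairs of faces \<open>\<sigma> \<subseteq> \<tau>\<close> is \<open>1\<close>, because the inner alternating
  sum over the subsets of \<open>\<tau>\<close> vanishes unless \<open>\<tau>\<close> is empty. Summing over \<open>\<tau>\<close> first instead gives
  \<open>a {} + (-1) ^ d * (a {} - 1)\<close> for an Eulerian manifold, and with \<open>d\<close> even the resulting
  equation \<open>2 * a {} - 1 = 1\<close> yields \<open>a {} = 1\<close>.
\<close>

section \<open>Face numbers and the Euler characteristic\<close>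

definition coface_sum :: "'a set set \<Rightarrow> 'a set \<Rightarrow> int" where
  "coface_sum K s = (\<Sum>t | t \<in> K \<and> s \<subseteq> t. (-1) ^ card t)"

lemma f_num_eq_card: "f_num K (int i - 1) = card {s \<in> K. card s = i}"
  by (simp add: f_num_def face_dim_def)

lemma card_le_complex_rank:
  assumes "finite K" "s \<in> K"
  shows "card s \<le> complex_rank K"
proof -
  have "face_dim s \<le> complex_dim K"
    unfolding complex_dim_def using assms by (intro Max_ge) auto
  then show ?thesis
    by (simp add: complex_rank_def face_dim_def)
qed

lemma int_complex_rank:
  assumes "finite K" "K \<noteq> {}"
  shows "int (complex_rank K) = complex_dim K + 1"
proof -
  have "complex_dim K \<in> face_dim ` K"
    unfolding complex_dim_def using assms by (intro Max_in) auto
  then have "-1 \<le> complex_dim K"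
    by (auto simp: face_dim_def)
  then show ?thesis
    by (simp add: complex_rank_def)
qed

lemma sum_over_faces_by_card:
  fixes g :: "nat \<Rightarrow> int"
  assumes "finite K"
  shows "(\<Sum>i=0..complex_rank K. g i * int (f_num K (int i - 1))) = (\<Sum>s\<in>K. g (card s))"
proof -
  have "(\<Sum>s\<in>K. g (card s)) = (\<Sum>i=0..complex_rank K. \<Sum>s | s \<in> K \<and> card s = i. g (card s))"
    using assms card_le_complex_rank[OF assms] by (intro sum.group[symmetric]) auto
  also have "\<dots> = (\<Sum>i=0..complex_rank K. g i * int (f_num K (int i - 1)))"
    by (intro sum.cong) (simp_all add: f_num_eq_card)
  finally show ?thesis ..
qed

text \<open>The unreduced characteristic differs from the alternating sum by cardinality in sign and in
  the term \<open>1\<close> of the empty face. The family of faces is a general one that contains the empty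
  set, so that the formula applies to links as well as to whole complexes.\<close>

lemma euler_char_eq_alternating_sum:
  assumes "finite K" "{} \<in> K" "\<forall>s\<in>K. finite s"
  shows "euler_char K = 1 - (\<Sum>s\<in>K. (-1) ^ card s)"
proof -
  let ?d = "complex_rank K"
  have d: "complex_dim K = int ?d - 1"
    using int_complex_rank[of K] assms by force
  have "euler_char K = (\<Sum>i=1..?d. (-1) ^ (i - 1) * int (f_num K (int i - 1)))"
    unfolding euler_char_def
    by (rule sum.reindex_bij_witness[of _ "\<lambda>i. int i - 1" "\<lambda>j. nat (j + 1)"])
      (use d in \<open>auto simp: nat_diff_distrib' nat_add_distrib\<close>)
  also have "\<dots> = (\<Sum>i=1..?d. - ((-1) ^ i * int (f_num K (int i - 1))))"
    by (intro sum.cong) (auto simp: power_eq_if)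
  also have "\<dots> = int (f_num K (int 0 - 1)) - (\<Sum>i=0..?d. (-1) ^ i * int (f_num K (int i - 1)))"
    by (simp add: sum_negf sum.atLeast_Suc_atMost)
  also have "f_num K (int 0 - 1) = 1"
  proof -
    have "{s \<in> K. card s = 0} = {{}}"
      using assms by auto
    then show ?thesis
      unfolding f_num_eq_card by simp
  qed
  finally show ?thesis
    by (simp add: sum_over_faces_by_card assms)
qed

section \<open>The e-vector as a sum over pairs of faces\<close>

text \<open>The sign is written with exponent \<open>n + k\<close>, of the same parity as \<open>n - k\<close>, so that it splits
  into a factor for \<open>n\<close> and a factor for \<open>k\<close> without truncation.\<close>

lemma coeff_power_minus_one:
  "coeff ([:-1, 1:] ^ n) k = (-1) ^ (n + k) * int (n choose k)"
proof (cases "k \<le> n")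
  case True
  then have "(-1 :: int) ^ (n - k) = (-1) ^ (n + k)"
    by (simp add: minus_one_power_iff)
  with True show ?thesis
    by (simp add: coeff_linear_poly_power)
next
  case False
  then have "degree ([:-1, 1:] ^ n :: int poly) < k"
    by (simp add: degree_linear_power)
  with False show ?thesis
    by (simp add: coeff_eq_0 binomial_eq_0)
qed

lemma e_num_eq_sum_over_faces:
  assumes "finite K"
  shows "e_num K k = (\<Sum>t\<in>K. (-1) ^ (card t + k) * int (card t choose k))"
  unfolding sum_over_faces_by_card[OF assms, of "\<lambda>i. (-1) ^ (i + k) * int (i choose k)", symmetric]
    e_num_def e_poly_def
  by (simp add: coeff_sum coeff_power_minus_one mult.commute)

text \<open>Both uses of the double count of pairs of comparable faces, the formula for \<open>e\<^sub>k\<close> and the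
  self-duality, are this exchange of summation, with different weights \<open>w\<close> on the smaller
  face.\<close>

lemma sum_coface_sum_swap:
  assumes "abstract_simplicial_complex K"
  shows "(\<Sum>s\<in>K. w s * coface_sum K s) = (\<Sum>t\<in>K. (-1) ^ card t * (\<Sum>s\<in>Pow t. w s))"
proof -
  have fin: "finite K" and down: "\<And>s t. t \<in> K \<Longrightarrow> s \<subseteq> t \<Longrightarrow> s \<in> K"
    using assms by (auto simp: abstract_simplicial_complex_def)
  have "(\<Sum>s\<in>K. w s * coface_sum K s) = (\<Sum>s\<in>K. \<Sum>t | t \<in> K \<and> s \<subseteq> t. w s * (-1) ^ card t)"
    by (simp add: coface_sum_def sum_distrib_left)
  also have "\<dots> = (\<Sum>t\<in>K. \<Sum>s | s \<in> K \<and> s \<subseteq> t. w s * (-1) ^ card t)"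
    using fin by (intro sum.swap_restrict)
  also have "\<dots> = (\<Sum>t\<in>K. (-1) ^ card t * (\<Sum>s\<in>Pow t. w s))"
  proof (rule sum.cong)
    fix t assume "t \<in> K"
    then have "{s. s \<in> K \<and> s \<subseteq> t} = Pow t"
      using down by auto
    then show "(\<Sum>s | s \<in> K \<and> s \<subseteq> t. w s * (-1) ^ card t) = (-1) ^ card t * (\<Sum>s\<in>Pow t. w s)"
      by (simp add: sum_distrib_right mult.commute[of "(-1) ^ card t"])
  qed simp
  finally show ?thesis .
qed

lemma e_num_eq_coface_sums:
  assumes "abstract_simplicial_complex K"
  shows "e_num K k = (-1) ^ k * (\<Sum>s | s \<in> K \<and> card s = k. coface_sum K s)"
proof -
  have fin: "finite K" and finite_face: "\<And>t. t \<in> K \<Longrightarrow> finite t"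
    using assms by (auto simp: abstract_simplicial_complex_def)
  have subsets: "(\<Sum>s\<in>Pow t. of_bool (card s = k)) = int (card t choose k)" if "t \<in> K" for t
  proof -
    have "Pow t \<inter> {s. card s = k} = {s. s \<subseteq> t \<and> card s = k}"
      by auto
    then show ?thesis
      using finite_face[OF that] by (simp add: n_subsets)
  qed
  have "(\<Sum>s | s \<in> K \<and> card s = k. coface_sum K s) = (\<Sum>s\<in>K. of_bool (card s = k) * coface_sum K s)"
    using fin by (intro sum.mono_neutral_cong_left) auto
  also have "\<dots> = (\<Sum>t\<in>K. (-1) ^ card t * int (card t choose k))"
    by (simp add: sum_coface_sum_swap[OF assms] subsets)
  finally show ?thesis
    by (simp add: e_num_eq_sum_over_faces[OF fin] sum_distrib_left power_add mult_ac)
qed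

lemma sum_alternating_Pow:
  assumes "finite t"
  shows "(\<Sum>s\<in>Pow t. (-1) ^ card s) = (of_bool (t = {}) :: int)"
proof -
  \<comment> \<open>The sum over subsets is the expansion of the product of the factors \<open>1 - 1\<close>.\<close>
  have "(\<Prod>x\<in>t. (1 - 1 :: int)) = (\<Sum>s\<in>Pow t. (-1) ^ card s * (\<Prod>x\<in>s. 1) * (\<Prod>x\<in>t - s. 1))"
    using assms by (rule prod_diff_conv_sum)
  then show ?thesis
    using assms by (cases "t = {}") (simp_all add: power_0_left)
qed

text \<open>Self-duality: for a fixed larger face, the smaller one runs over all of its subsets, and
  their alternating sum vanishes unless the larger face is empty.\<close>

lemma sum_signed_coface_sum:
  assumes "abstract_simplicial_complex K"
  shows "(\<Sum>s\<in>K. (-1) ^ card s * coface_sum K s) = 1"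
proof -
  have fin: "finite K" and empty: "{} \<in> K" and finite_face: "\<And>t. t \<in> K \<Longrightarrow> finite t"
    using assms by (auto simp: abstract_simplicial_complex_def)
  have "(\<Sum>s\<in>K. (-1) ^ card s * coface_sum K s) = (\<Sum>t\<in>K. if t = {} then 1 else 0)"
    unfolding sum_coface_sum_swap[OF assms]
    using finite_face by (intro sum.cong) (simp_all add: sum_alternating_Pow)
  then show ?thesis
    using fin empty by simp
qed

section \<open>Eulerian manifolds\<close>

text \<open>Adjoining \<open>s\<close> is a bijection from the link of \<open>s\<close> onto the faces containing \<open>s\<close>, and it
  raises cardinalities by \<open>|s|\<close>.\<close>

lemma coface_sum_eq_euler_char_link:
  assumes "abstract_simplicial_complex K" "s \<in> K"
  shows "coface_sum K s = (-1) ^ card s * (1 - euler_char (face_link K s))"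
proof -
  have fin: "finite K" and empty: "{} \<in> K" and finite_face: "\<And>t. t \<in> K \<Longrightarrow> finite t"
    and down: "\<And>s t. t \<in> K \<Longrightarrow> s \<subseteq> t \<Longrightarrow> s \<in> K"
    using assms by (auto simp: abstract_simplicial_complex_def)
  have "coface_sum K s = (\<Sum>u\<in>face_link K s. (-1) ^ card (s \<union> u))"
    unfolding coface_sum_def
    by (rule sum.reindex_bij_witness[of _ "\<lambda>u. s \<union> u" "\<lambda>t. t - s"])
      (auto simp: face_link_def Un_absorb1 intro: down)
  also have "\<dots> = (\<Sum>u\<in>face_link K s. (-1) ^ card s * (-1) ^ card u)"
    using finite_face assms(2)
    by (intro sum.cong) (auto simp: face_link_def card_Un_disjoint power_add)
  also have "\<dots> = (-1) ^ card s * (1 - euler_char (face_link K s))"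
    using fin empty finite_face assms(2)
    by (subst euler_char_eq_alternating_sum) (auto simp: face_link_def sum_distrib_left)
  finally show ?thesis .
qed

lemma face_link_empty: "face_link K {} = K"
  by (auto simp: face_link_def)

lemma coface_sum_eulerian_manifold:
  assumes "abstract_simplicial_complex K" "eulerian_manifold K" "s \<in> K" "s \<noteq> {}"
  shows "coface_sum K s = (-1) ^ complex_rank K"
proof -
  let ?d = "complex_rank K"
  have le: "card s \<le> ?d"
    using assms by (intro card_le_complex_rank) (auto simp: abstract_simplicial_complex_def)
  then have "nat (int ?d - face_dim s) = ?d - card s + 1"
    by (simp add: face_dim_def)
  then have "euler_char (face_link K s) = 1 + (-1) ^ (?d - card s + 1)"
    using assms by (simp add: eulerian_manifold_def)
  then have "coface_sum K s = (-1) ^ card s * (-1) ^ (?d - card s)"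
    by (simp add: coface_sum_eq_euler_char_link[OF assms(1,3)])
  then show ?thesis
    using le by (simp flip: power_add)
qed

text \<open>In even rank every nonempty face has coface sum \<open>1\<close>, so the self-duality identity becomes a
  linear equation in the one remaining unknown \<open>coface_sum K {}\<close>, whose coefficient is \<open>2\<close>. In
  odd rank that coefficient would be \<open>0\<close>.\<close>

lemma coface_sum_empty_even_rank:
  assumes "abstract_simplicial_complex K" "eulerian_manifold K" "even (complex_rank K)"
  shows "coface_sum K {} = 1"
proof -
  have fin: "finite K" and empty: "{} \<in> K"
    using assms by (auto simp: abstract_simplicial_complex_def)
  have coface: "coface_sum K s = 1" if "s \<in> K - {{}}" for s
    using coface_sum_eulerian_manifold[OF assms(1,2)] that assms(3) by simp
  have "1 = coface_sum K {} + (\<Sum>s\<in>K - {{}}. (-1) ^ card s * coface_sum K s)"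
    using sum_signed_coface_sum[OF assms(1)]
      sum.remove[OF fin empty, of "\<lambda>s. (-1) ^ card s * coface_sum K s"] by simp
  also have "(\<Sum>s\<in>K - {{}}. (-1) ^ card s * coface_sum K s) = (\<Sum>s\<in>K - {{}}. (-1) ^ card s)"
    by (intro sum.cong) (simp_all add: coface)
  \<comment> \<open>The alternating sum over all faces is itself \<open>coface_sum K {}\<close>.\<close>
  also have "\<dots> = coface_sum K {} - 1"
    using sum.remove[OF fin empty, of "\<lambda>s. (-1 :: int) ^ card s"] by (simp add: coface_sum_def)
  finally show ?thesis
    by simp
qed

lemma coface_sum_empty_eulerian_sphere:
  assumes "abstract_simplicial_complex K" "eulerian_sphere K"
  shows "coface_sum K {} = (-1) ^ complex_rank K"
  using assms coface_sum_eq_euler_char_link[OF assms(1), of "{}"]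
  by (simp add: eulerian_sphere_def face_link_empty abstract_simplicial_complex_def)

lemma property_E_at_if_coface_sums:
  assumes "abstract_simplicial_complex K" "k \<le> complex_rank K"
    and "\<And>s. s \<in> K \<Longrightarrow> card s = k \<Longrightarrow> coface_sum K s = (-1) ^ complex_rank K"
  shows "e_num K k = (-1) ^ (complex_rank K - k) * int (f_num K (int k - 1))"
proof -
  let ?d = "complex_rank K"
  have "e_num K k = (-1) ^ (k + ?d) * int (f_num K (int k - 1))"
    by (simp add: e_num_eq_coface_sums[OF assms(1)] assms(3) f_num_eq_card power_add)
  also have "(-1 :: int) ^ (k + ?d) = (-1) ^ (?d - k)"
    using assms(2) by (simp add: minus_one_power_iff)
  finally show ?thesis .
qed

theorem theorem5:
  fixes K :: "'a set set"
  assumes "abstract_simplicial_complex K"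
    and "eulerian_manifold K"
  shows "weak_property_E K \<and>
    (odd (complex_dim K) \<or> eulerian_sphere K \<longrightarrow> property_E K)"
proof (intro conjI impI)
  let ?d = "complex_rank K"
  let ?E_at = "\<lambda>k. e_num K k = (-1) ^ (?d - k) * int (f_num K (int k - 1))"
  have pos: "?E_at k" if "1 \<le> k" "k \<le> ?d" for k
  proof (rule property_E_at_if_coface_sums[OF assms(1) that(2)])
    fix s assume "s \<in> K" "card s = k"
    moreover from this that(1) have "s \<noteq> {}"
      by auto
    ultimately show "coface_sum K s = (-1) ^ ?d"
      by (intro coface_sum_eulerian_manifold[OF assms])
  qed
  then show "weak_property_E K"
    by (simp add: weak_property_E_def)
  assume "odd (complex_dim K) \<or> eulerian_sphere K"
  then have empty: "coface_sum K {} = (-1) ^ ?d"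
  proof
    assume "odd (complex_dim K)"
    moreover have "int ?d = complex_dim K + 1"
      using assms(1) by (intro int_complex_rank) (auto simp: abstract_simplicial_complex_def)
    ultimately have "even ?d"
      by presburger
    then show ?thesis
      using coface_sum_empty_even_rank[OF assms] by simp
  next
    assume "eulerian_sphere K"
    then show ?thesis
      by (rule coface_sum_empty_eulerian_sphere[OF assms(1)])
  qed
  have "?E_at 0"
  proof (rule property_E_at_if_coface_sums[OF assms(1)])
    fix s assume "s \<in> K" "card s = 0"
    then have "s = {}"
      using assms(1) by (auto simp: abstract_simplicial_complex_def)
    with empty show "coface_sum K s = (-1) ^ ?d"
      by simp
  qed simp
  with pos show "property_E K"
    unfolding property_E_def by (metis One_nat_def Suc_leI atLeastAtMost_iff neq0_conv)
qed

end
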